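(* Let $n\ge2$, $p_1\in(0,1)$, and let $RSC_n=RSC(n,p_1,p_2,p_3)$ be a random spiro chain. Let $R_n=\sum_{uv\in E(RSC_n)}(d_ud_v)^{-1/2}$ (Randić index), $N_n=\sum_{uv\in E(RSC_n)}\sqrt{d_u+d_v}$ (Nirmala index), $S_n=\sum_{uv\in E(RSC_n)}\sqrt{d_u^2+d_v^2}$ (Sombor index), $M1_n=\sum_{v\in V(RSC_n)}d_v^2$ (first Zagreb index), and $M2_n=\sum_{uv\in E(RSC_n)}d_ud_v$ (second Zagreb index). Then $$\mathbb{E}(R_n)\le\mathbb{E}(N_n)\le\mathbb{E}(S_n)\le\mathbb{E}(M1_n)\le\mathbb{E}(M2_n)$$ and $$V(R_n)\le V(N_n)\le V(S_n)\le V(M2_n),$$ where $\mathbb{E}$ and $V$ denote expectation and variance.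
   Context: For a finite simple graph $G$, $V(G)$ and $E(G)$ are its vertex and edge sets and $d_v$ is the degree of the vertex $v$. Random spiro chain. Fix $p_1,p_2,p_3$ with $0<p_i<1$ and $p_1+p_2+p_3=1$. The random spiro chain $RSC_n=RSC(n,p_1,p_2,p_3)$ with $n$ hexagons is built as follows. $RSC_1$ is a hexagon $H_1$ (a 6-cycle). $RSC_2$ consists of two hexagons $H_1,H_2$ sharing exactly one vertex. For $n>2$, $RSC_n$ is obtained from $RSC_{n-1}$ by attaching a new hexagon $H_n$ to the last hexagon $H_{n-1}$, identifying one vertex of $H_n$ with a vertex $w$ of $H_{n-1}$, where $w$ is at distance $i\in\{1,2,3\}$ (in the 6-cycle $H_{n-1}$) from the vertex that $H_{n-1}$ shares with $H_{n-2}$. Case $i$ is chosen with probability $p_i$, independently of the previous choices. *)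

theory Defs
  imports "HOL-Probability.Probability"
begin

section \<open>Finite simple graphs and degree-based indices\<close>

record 'v graph =
  verts :: "'v set"
  edges :: "'v set set"

definition vertex_degree :: "'v graph \<Rightarrow> 'v \<Rightarrow> nat" where
  "vertex_degree G v = card {e \<in> edges G. v \<in> e}"

definition graph_union :: "'v graph \<Rightarrow> 'v graph \<Rightarrow> 'v graph" where
  "graph_union G H = \<lparr>verts = verts G \<union> verts H, edges = edges G \<union> edges H\<rparr>"

definition graph_dist :: "'v graph \<Rightarrow> 'v \<Rightarrow> 'v \<Rightarrow> nat" where
  "graph_dist G u v = (LEAST k. (u, v) \<in> {(x, y). {x, y} \<in> edges G} ^^ k)"

definition cycle_graph :: "'v list \<Rightarrow> 'v graph" where
  "cycle_graph xs =
     \<lparr>verts = set xs, edges = {{xs ! j, xs ! (Suc j mod length xs)} | j. j < length xs}\<rparr>"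

text \<open>An edge \<open>uv\<close> is the two-element set \<open>e = {u, v}\<close>, so that, e.g., the product
  \<open>d\<^sub>u d\<^sub>v\<close> is the product of the degrees over \<open>e\<close>.\<close>

definition randic_index :: "'v graph \<Rightarrow> real" where
  "randic_index G = (\<Sum>e\<in>edges G. (\<Prod>v\<in>e. real (vertex_degree G v)) powr (- 1 / 2))"

definition nirmala_index :: "'v graph \<Rightarrow> real" where
  "nirmala_index G = (\<Sum>e\<in>edges G. sqrt (\<Sum>v\<in>e. real (vertex_degree G v)))"

definition sombor_index :: "'v graph \<Rightarrow> real" where
  "sombor_index G = (\<Sum>e\<in>edges G. sqrt (\<Sum>v\<in>e. (real (vertex_degree G v))\<^sup>2))"

definition first_zagreb_index :: "'v graph \<Rightarrow> real" where
  "first_zagreb_index G = (\<Sum>v\<in>verts G. (real (vertex_degree G v))\<^sup>2)"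

definition second_zagreb_index :: "'v graph \<Rightarrow> real" where
  "second_zagreb_index G = (\<Sum>e\<in>edges G. \<Prod>v\<in>e. real (vertex_degree G v))"


section \<open>Random spiro chains\<close>

type_synonym vertex = "nat \<times> nat"

text \<open>\<open>hexagon k w\<close> is the \<open>k\<close>-th hexagon, already identified along \<open>w\<close>; its other five
  vertices \<open>(k, 1), \<dots>, (k, 5)\<close> are fresh.\<close>

definition hexagon :: "nat \<Rightarrow> vertex \<Rightarrow> vertex graph" where
  "hexagon k w = cycle_graph (w # map (Pair k) [1..<6])"

definition arrangement_pmf :: "real \<Rightarrow> real \<Rightarrow> real \<Rightarrow> nat pmf" where
  "arrangement_pmf p1 p2 p3 = pmf_of_list [(1, p1), (2, p2), (3, p3)]"

text \<open>For \<open>i = 1, 2\<close> there are two vertices at distance \<open>i\<close> from \<open>v\<close> in the hexagon \<open>H\<close>;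
  reflecting \<open>H\<close> in the axis through \<open>v\<close> exchanges them, so the choice does not affect
  the resulting chain up to isomorphism.\<close>

definition attachment_vertex :: "vertex graph \<Rightarrow> vertex \<Rightarrow> nat \<Rightarrow> vertex" where
  "attachment_vertex H v i = (SOME w. w \<in> verts H \<and> graph_dist H v w = i)"

lemma hexagon_explicit: "hexagon k w = \<lparr>verts = {w,(k,1),(k,2),(k,3),(k,4),(k,5)},
  edges = {{w,(k,1)},{(k,1),(k,2)},{(k,2),(k,3)},{(k,3),(k,4)},{(k,4),(k,5)},{(k,5),w}}\<rparr>"
proof -
  have u: "[1..<6] = [1::nat,2,3,4,5]" by (simp add: upt_rec)
  have "{f j |j. j < (6::nat)} = {f 0, f 1, f 2, f 3, f 4, f 5}" for f :: "nat \<Rightarrow> 'b"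
  proof -
    have "{j. j < (6::nat)} = {0,1,2,3,4,5}" by auto
    then show ?thesis by (auto simp: less_Suc_eq numeral_eq_Suc)
  qed
  note s = this
  have l: "length (w # map (Pair k) [1,2,3,4,5]) = 6" by simp
  show ?thesis unfolding hexagon_def cycle_graph_def u l s by simp
qed

lemma attachment_vertex_correct:
  assumes "w \<notin> {(k,1),(k,2),(k,3),(k,4),(k,5)}" "i \<in> {1,2,3}"
  shows "attachment_vertex (hexagon k w) w i \<in> verts (hexagon k w) \<and>
    graph_dist (hexagon k w) w (attachment_vertex (hexagon k w) w i) = i"
proof -
  define R where "R = {(x, y). {x, y} \<in> edges (hexagon k w)}"
  have I: "{(x, y). {x, y} \<in> insert {a, b} E} = insert (a, b) (insert (b, a) {(x, y). {x, y} \<in> E})"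
    for a b :: vertex and E by (auto simp: doubleton_eq_iff)
  have R: "R = {(w,(k,1)),((k,1),w),((k,1),(k,2)),((k,2),(k,1)),((k,2),(k,3)),((k,3),(k,2)),
      ((k,3),(k,4)),((k,4),(k,3)),((k,4),(k,5)),((k,5),(k,4)),((k,5),w),(w,(k,5))}"
    unfolding R_def hexagon_explicit graph.simps I by simp
  have ne: "w \<noteq> (k,1)" "w \<noteq> (k,2)" "w \<noteq> (k,3)" "w \<noteq> (k,4)" "w \<noteq> (k,5)" using assms(1) by auto
  have C: "insert (a, b) S `` {x} = (if x = a then insert b (S `` {x}) else S `` {x})"
    for a b x :: vertex and S by auto
  have N: "R `` {w} = {(k,1),(k,5)}" "R `` {(k,1)} = {w,(k,2)}" "R `` {(k,5)} = {w,(k,4)}"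
    "R `` {(k,2)} = {(k,1),(k,3)}" "R `` {(k,4)} = {(k,3),(k,5)}"
    unfolding R C using ne by (simp_all add: insert_commute ne[symmetric])
  have U: "R `` insert x A = R `` {x} \<union> R `` A" for x A by blast
  have S: "(R ^^ Suc n) `` A = R `` ((R ^^ n) `` A)" for n A by auto
  have r0: "(R ^^ 0) `` {w} = {w}" by auto
  have r1: "(R ^^ 1) `` {w} = {(k,1),(k,5)}"
    unfolding One_nat_def S r0 N ..
  have r2: "(R ^^ 2) `` {w} = {w,(k,2),(k,4)}"
    unfolding numeral_2_eq_2 One_nat_def[symmetric] S r1 unfolding U[of _ "{_}"] N
    by (simp add: insert_commute numeral_2_eq_2)
  have r3: "(R ^^ 3) `` {w} = {(k,1),(k,5),(k,3)}"
    unfolding numeral_3_eq_3 numeral_2_eq_2[symmetric] S r2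
    unfolding U[of _ "insert _ _"] U[of _ "{_}"] N by auto
  have "graph_dist (hexagon k w) w (k,i) = i"
    unfolding graph_dist_def R_def[symmetric]
  proof (rule Least_equality)
    have "(k,i) \<in> (R ^^ i) `` {w}" using assms(2) r1 r2 r3 by (elim insertE emptyE) simp_all
    then show "(w,(k,i)) \<in> R ^^ i" by simp
  next
    fix y assume "(w,(k,i)) \<in> R ^^ y"
    then have y: "(k,i) \<in> (R ^^ y) `` {w}" by simp
    show "i \<le> y"
    proof (rule ccontr)
      assume "\<not> i \<le> y"
      then have "y = 0 \<or> y = 1 \<and> i \<noteq> 1 \<or> y = 2 \<and> i = 3" using assms(2) by auto
      then show False
      proof (elim disjE conjE)
        assume "y = 0"
        then have "(k,i) = w" using y r0 by simp
        then show False using assms by auto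
      next
        assume "y = 1" "i \<noteq> 1"
        then have "(k,i) \<in> {(k,1),(k,5)}" using y r1 by metis
        then show False using assms(2) \<open>i \<noteq> 1\<close> by auto
      next
        assume "y = 2" "i = 3"
        then have "(k,3) \<in> {w,(k,2),(k,4)}" using y r2 by metis
        then show False using assms(1) by auto
      qed
    qed
  qed
  moreover have "(k,i) \<in> verts (hexagon k w)" using assms(2) by (auto simp: hexagon_explicit)
  ultimately show ?thesis unfolding attachment_vertex_def
    by (intro someI[of "\<lambda>x. x \<in> verts (hexagon k w) \<and> graph_dist (hexagon k w) w x = i" "(k,i)"]) simp
qed

text \<open>The state \<open>(G, H, v)\<close> consists of the chain \<open>G\<close> with \<open>n\<close> hexagons, its last hexagon
  \<open>H\<close>, and the vertex \<open>v\<close> that \<open>H\<close> shares with the previous hexagon (for \<open>n = 1\<close>, where there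
  is no previous hexagon, the component \<open>v\<close> is a dummy). The case \<open>n = 0\<close> is left unspecified.\<close>

fun spiro_state ::
    "real \<Rightarrow> real \<Rightarrow> real \<Rightarrow> nat \<Rightarrow> (vertex graph \<times> vertex graph \<times> vertex) pmf" where
  "spiro_state p1 p2 p3 (Suc 0) =
     return_pmf (hexagon 1 (1, 0), hexagon 1 (1, 0), (1, 0))"
| "spiro_state p1 p2 p3 (Suc (Suc 0)) =
     return_pmf (graph_union (hexagon 1 (1, 0)) (hexagon 2 (1, 0)), hexagon 2 (1, 0), (1, 0))"
| "spiro_state p1 p2 p3 (Suc (Suc (Suc m))) =
     do {
       (G, H, v) \<leftarrow> spiro_state p1 p2 p3 (Suc (Suc m));
       i \<leftarrow> arrangement_pmf p1 p2 p3;
       let w = attachment_vertex H v i;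
       let H' = hexagon (Suc (Suc (Suc m))) w;
       return_pmf (graph_union G H', H', w)
     }"

definition random_spiro_chain :: "real \<Rightarrow> real \<Rightarrow> real \<Rightarrow> nat \<Rightarrow> vertex graph pmf" where
  "random_spiro_chain p1 p2 p3 n = map_pmf fst (spiro_state p1 p2 p3 n)"

end

theory Submission
  imports Defs
begin

text \<open>
  A chain of \<open>n\<close> hexagons has \<open>6 n\<close> edges; its \<open>n - 1\<close> cut vertices have degree 4 and all
  its other vertices have degree 2, because a new hexagon is never glued to the vertex that the
  last hexagon shares with its predecessor. Both halves of the theorem follow from this.

  The expectations are compared pointwise. The handshake identity \<open>weighted_handshake\<close> turns the
  first Zagreb index into the edge sum of \<open>d\<^sub>u + d\<^sub>v\<close>, so that all five indices are edge sums, and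
  for \<open>a, b \<ge> 2\<close> one has
  \<open>1 / sqrt (a b) \<le> sqrt (a + b) \<le> sqrt (a\<^sup>2 + b\<^sup>2) \<le> a + b \<le> a b\<close>.

  For the variances, the randomness enters only through the number \<open>X\<close> of edges joining two
  vertices of degree 4. Indeed the edge set has size \<open>6 n\<close>, and the same handshake identity shows
  that the edge ends of degree 4 number \<open>4 (n - 1)\<close>. So the numbers of edges of types (2,2), (2,4)
  and (4,4) are affine functions of \<open>X\<close>, and every edge sum of a symmetric \<open>f d\<^sub>u d\<^sub>v\<close> is
  a constant plus \<open>c X\<close> with the second difference \<open>c = f 2 2 - 2 f 2 4 + f 4 4\<close>
  (lemma \<open>spiro_edge_sum\<close>). Its variance is therefore \<open>c\<^sup>2\<close> times that of \<open>X\<close>, and it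
  remains to compare the absolute values of \<open>c\<close>, which are about
  0.043, 0.071, 0.459 and 4 for the Randic, Nirmala, Sombor and second Zagreb indices.
\<close>

section \<open>Edge sums in simple graphs\<close>

definition simple_graph :: "'v graph \<Rightarrow> bool" where
  "simple_graph G \<longleftrightarrow> finite (verts G) \<and> (\<forall>e\<in>edges G. e \<subseteq> verts G \<and> card e = 2)"

lemma simple_graph_finite_edges:
  assumes "simple_graph G"
  shows "finite (edges G)"
proof -
  have "edges G \<subseteq> Pow (verts G)" using assms by (auto simp: simple_graph_def)
  then show ?thesis using assms finite_subset by (auto simp: simple_graph_def)
qed

lemma simple_graph_edgeE:
  assumes "simple_graph G" "e \<in> edges G"
  obtains u v where "e = {u, v}" "u \<noteq> v" "u \<in> verts G" "v \<in> verts G"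
proof -
  have "card e = 2" "e \<subseteq> verts G" using assms by (auto simp: simple_graph_def)
  then show ?thesis using that by (auto simp: card_2_iff)
qed

lemma vertex_degree_eq_sum:
  assumes "finite (edges G)"
  shows "vertex_degree G v = (\<Sum>e\<in>edges G. of_bool (v \<in> e))"
  using assms unfolding vertex_degree_def by (simp add: sum.If_cases of_bool_def Int_def)

lemma vertex_degree_outside:
  assumes "simple_graph G" "v \<notin> verts G"
  shows "vertex_degree G v = 0"
proof -
  have "{e \<in> edges G. v \<in> e} = {}" using assms by (auto simp: simple_graph_def)
  then show ?thesis by (simp only: vertex_degree_def card.empty)
qed

text \<open>Double counting of the pairs of a vertex and an edge through it.\<close>

lemma weighted_handshake:
  fixes g :: "'v \<Rightarrow> real"
  assumes "simple_graph G"
  shows "(\<Sum>v\<in>verts G. real (vertex_degree G v) * g v) = (\<Sum>e\<in>edges G. \<Sum>v\<in>e. g v)"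
proof -
  have fin: "finite (verts G)" "finite (edges G)"
    using assms simple_graph_finite_edges by (auto simp: simple_graph_def)
  have "(\<Sum>v\<in>verts G. real (vertex_degree G v) * g v)
      = (\<Sum>v\<in>verts G. \<Sum>e\<in>edges G. of_bool (v \<in> e) * g v)"
    using fin by (simp add: vertex_degree_eq_sum sum_distrib_right)
  also have "\<dots> = (\<Sum>e\<in>edges G. \<Sum>v\<in>verts G. of_bool (v \<in> e) * g v)"
    by (rule sum.swap)
  also have "\<dots> = (\<Sum>e\<in>edges G. \<Sum>v\<in>e. g v)"
  proof (rule sum.cong)
    fix e assume "e \<in> edges G"
    then have "e \<subseteq> verts G" using assms by (auto simp: simple_graph_def)
    then show "(\<Sum>v\<in>verts G. of_bool (v \<in> e) * g v) = (\<Sum>v\<in>e. g v)"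
      using fin by (intro sum.mono_neutral_cong_right) auto
  qed simp
  finally show ?thesis .
qed

lemma first_zagreb_index_eq_edge_sum:
  assumes "simple_graph G"
  shows "first_zagreb_index G = (\<Sum>e\<in>edges G. \<Sum>v\<in>e. real (vertex_degree G v))"
  using weighted_handshake[OF assms, of "\<lambda>v. real (vertex_degree G v)"]
  by (simp add: first_zagreb_index_def power2_eq_square)

lemma simple_graph_edge_sum_mono:
  fixes f g :: "real \<Rightarrow> real \<Rightarrow> real"
  assumes "simple_graph G" "\<And>v. v \<in> verts G \<Longrightarrow> vertex_degree G v \<ge> 2"
    and "\<And>u v. u \<noteq> v \<Longrightarrow> \<phi> {u, v} = f (vertex_degree G u) (vertex_degree G v)"
    and "\<And>u v. u \<noteq> v \<Longrightarrow> \<psi> {u, v} = g (vertex_degree G u) (vertex_degree G v)"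
    and "\<And>a b. a \<ge> 2 \<Longrightarrow> b \<ge> 2 \<Longrightarrow> f a b \<le> g a b"
  shows "sum \<phi> (edges G) \<le> sum \<psi> (edges G)"
proof (rule sum_mono)
  fix e assume "e \<in> edges G"
  with assms(1) obtain u v where e: "e = {u, v}" "u \<noteq> v" "u \<in> verts G" "v \<in> verts G"
    by (rule simple_graph_edgeE)
  show "\<phi> e \<le> \<psi> e"
    using e assms(2)[OF e(3)] assms(2)[OF e(4)] by (simp add: assms(3-5))
qed

lemma randic_index_le_nirmala_index:
  assumes "simple_graph G" "\<And>v. v \<in> verts G \<Longrightarrow> vertex_degree G v \<ge> 2"
  shows "randic_index G \<le> nirmala_index G"
  unfolding randic_index_def nirmala_index_def
proof (rule simple_graph_edge_sum_mono[OF assms, where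
      f = "\<lambda>a b. (a * b) powr (- 1 / 2)" and g = "\<lambda>a b. sqrt (a + b)"])
  fix a b :: real assume "a \<ge> 2" "b \<ge> 2"
  then have "1 * 1 \<le> a * b" by (intro mult_mono) auto
  then have "(a * b) powr (- 1 / 2) \<le> (a * b) powr 0" by (intro powr_mono) auto
  also have "\<dots> \<le> sqrt (a + b)" using \<open>a \<ge> 2\<close> \<open>b \<ge> 2\<close> by simp
  finally show "(a * b) powr (- 1 / 2) \<le> sqrt (a + b)" .
qed simp_all

lemma nirmala_index_le_sombor_index:
  assumes "simple_graph G" "\<And>v. v \<in> verts G \<Longrightarrow> vertex_degree G v \<ge> 2"
  shows "nirmala_index G \<le> sombor_index G"
  unfolding nirmala_index_def sombor_index_def
proof (rule simple_graph_edge_sum_mono[OF assms, where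
      f = "\<lambda>a b. sqrt (a + b)" and g = "\<lambda>a b. sqrt (a\<^sup>2 + b\<^sup>2)"])
  fix a b :: real assume "a \<ge> 2" "b \<ge> 2"
  then have "1 * a \<le> a * a" "1 * b \<le> b * b" by (intro mult_right_mono; simp)+
  then show "sqrt (a + b) \<le> sqrt (a\<^sup>2 + b\<^sup>2)" by (simp add: power2_eq_square)
qed simp_all

lemma sombor_index_le_first_zagreb_index:
  assumes "simple_graph G" "\<And>v. v \<in> verts G \<Longrightarrow> vertex_degree G v \<ge> 2"
  shows "sombor_index G \<le> first_zagreb_index G"
  unfolding sombor_index_def first_zagreb_index_eq_edge_sum[OF assms(1)]
  by (rule simple_graph_edge_sum_mono[OF assms, where
      f = "\<lambda>a b. sqrt (a\<^sup>2 + b\<^sup>2)" and g = "\<lambda>a b. a + b"])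
    (simp_all add: sqrt_sum_squares_le_sum)

lemma first_zagreb_index_le_second_zagreb_index:
  assumes "simple_graph G" "\<And>v. v \<in> verts G \<Longrightarrow> vertex_degree G v \<ge> 2"
  shows "first_zagreb_index G \<le> second_zagreb_index G"
  unfolding second_zagreb_index_def first_zagreb_index_eq_edge_sum[OF assms(1)]
proof (rule simple_graph_edge_sum_mono[OF assms, where
      f = "\<lambda>a b. a + b" and g = "\<lambda>a b. a * b"])
  fix a b :: real assume "a \<ge> 2" "b \<ge> 2"
  then have "1 * 1 \<le> (a - 1) * (b - 1)" by (intro mult_mono) auto
  then show "a + b \<le> a * b" by (simp add: algebra_simps)
qed simp_all

section \<open>Degrees in spiro chains\<close>

lemma hexagon_degree:
  assumes "w \<notin> {(k,1),(k,2),(k,3),(k,4),(k,5)}"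
  shows "vertex_degree (hexagon k w) v = (if v \<in> verts (hexagon k w) then 2 else 0)"
    and "card (edges (hexagon k w)) = 6"
proof -
  have ne: "w \<noteq> (k,1)" "w \<noteq> (k,2)" "w \<noteq> (k,3)" "w \<noteq> (k,4)" "w \<noteq> (k,5)"
    using assms by auto
  show "vertex_degree (hexagon k w) v = (if v \<in> verts (hexagon k w) then 2 else 0)"
    using ne ne[symmetric]
    by (subst vertex_degree_eq_sum) (auto simp: hexagon_explicit doubleton_eq_iff)
  show "card (edges (hexagon k w)) = 6"
    using ne ne[symmetric] by (simp add: hexagon_explicit doubleton_eq_iff)
qed

lemma hexagon_simple_graph:
  assumes "w \<notin> {(k,1),(k,2),(k,3),(k,4),(k,5)}"
  shows "simple_graph (hexagon k w)"
  using assms by (auto simp: simple_graph_def hexagon_explicit)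

text \<open>These graphs include branched trees of hexagons besides the values of the random chain: any
  vertex of degree 2 may receive the next hexagon, not only one of the last hexagon. The degree
  counts are the same for all of them, and the induction need not keep track of a last hexagon.\<close>

inductive spiro_graph :: "nat \<Rightarrow> vertex graph \<Rightarrow> bool" where
  single: "spiro_graph 1 (hexagon 1 (1, 0))"
| glue: "spiro_graph n G \<Longrightarrow> w \<in> verts G \<Longrightarrow> vertex_degree G w = 2 \<Longrightarrow>
    spiro_graph (Suc n) (graph_union G (hexagon (Suc n) w))"

lemma spiro_graph_verts:
  assumes "spiro_graph n G" "(k, j) \<in> verts G"
  shows "k \<le> n"
  using assms by (induction rule: spiro_graph.induct)
    (auto simp: hexagon_explicit graph_union_def)

lemma glue_degree:
  assumes "spiro_graph n G" "simple_graph G" "w \<in> verts G"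
  shows "vertex_degree (graph_union G (hexagon (Suc n) w)) v =
      vertex_degree G v + vertex_degree (hexagon (Suc n) w) v"
    and "card (edges (graph_union G (hexagon (Suc n) w))) = card (edges G) + 6"
    and "simple_graph (graph_union G (hexagon (Suc n) w))"
proof -
  let ?H = "hexagon (Suc n) w"
  have fresh: "(Suc n, j) \<notin> verts G" for j
    using spiro_graph_verts[OF assms(1), of "Suc n" j] by auto
  have w: "w \<notin> {(Suc n,1),(Suc n,2),(Suc n,3),(Suc n,4),(Suc n,5)}"
    using assms(3) fresh by auto
  have H: "simple_graph ?H" using hexagon_simple_graph[OF w] .
  note fin = simple_graph_finite_edges[OF assms(2)] simple_graph_finite_edges[OF H]
  \<comment> \<open>Edges are sets of vertices, so the union could merge a new edge with an old one; the fresh end of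
    each new edge excludes this.\<close>
  have "\<not> e \<subseteq> verts G" if "e \<in> edges ?H" for e
    using that fresh by (auto simp: hexagon_explicit)
  then have disj: "edges G \<inter> edges ?H = {}"
    using assms(2) by (auto simp: simple_graph_def)
  have fin_union: "finite (edges (graph_union G ?H))" using fin by (simp add: graph_union_def)
  show "vertex_degree (graph_union G ?H) v = vertex_degree G v + vertex_degree ?H v"
    unfolding vertex_degree_eq_sum[OF fin(1)] vertex_degree_eq_sum[OF fin(2)]
      vertex_degree_eq_sum[OF fin_union]
    unfolding graph_union_def graph.simps using fin disj by (rule sum.union_disjoint)
  show "card (edges (graph_union G ?H)) = card (edges G) + 6"
    using fin disj hexagon_degree(2)[OF w] by (simp add: graph_union_def card_Un_disjoint)
  show "simple_graph (graph_union G ?H)"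
    using assms(2) H by (auto simp: simple_graph_def graph_union_def)
qed

text \<open>Gluing changes the degree of the attachment vertex only, from 2 to 4; the other vertices of
  the new hexagon are new and get degree 2.\<close>

lemma spiro_graph_structure:
  assumes "spiro_graph n G"
  shows "simple_graph G \<and> card (edges G) = 6 * n \<and> n \<ge> 1
    \<and> (\<forall>v\<in>verts G. vertex_degree G v = 2 \<or> vertex_degree G v = 4)
    \<and> card {v \<in> verts G. vertex_degree G v = 4} = n - 1"
  using assms
proof (induction rule: spiro_graph.induct)
  case single
  have "(1, 0) \<notin> {(1,1),(1,2),(1,3),(1,4),(1::nat,5::nat)}" by simp
  note s = hexagon_degree[OF this] hexagon_simple_graph[OF this]
  have "{v \<in> verts (hexagon 1 (1, 0)). vertex_degree (hexagon 1 (1, 0)) v = 4} = {}"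
    unfolding s by auto
  then show ?case using s by simp
next
  case (glue n G w)
  let ?H = "hexagon (Suc n) w"
  let ?U = "graph_union G ?H"
  from glue.IH have G: "simple_graph G" "card (edges G) = 6 * n" "n \<ge> 1"
    "\<forall>v\<in>verts G. vertex_degree G v = 2 \<or> vertex_degree G v = 4"
    "card {v \<in> verts G. vertex_degree G v = 4} = n - 1" by auto
  note U = glue_degree[OF glue.hyps(1) G(1) glue.hyps(2)]
  have fresh: "(Suc n, j) \<notin> verts G" for j
    using spiro_graph_verts[OF glue.hyps(1), of "Suc n" j] by auto
  have wnew: "w \<notin> {(Suc n,1),(Suc n,2),(Suc n,3),(Suc n,4),(Suc n,5)}"
    using glue.hyps(2) fresh by auto
  have common: "v \<in> verts ?H \<longleftrightarrow> v = w" if "v \<in> verts G" for v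
    using that glue.hyps(2) fresh by (auto simp: hexagon_explicit)
  have outside: "vertex_degree G v = 0" if "v \<notin> verts G" for v
    using vertex_degree_outside[OF G(1) that] .
  have deg: "vertex_degree ?U v = (if v = w then 4 else if v \<in> verts G then vertex_degree G v else 2)"
    if "v \<in> verts ?U" for v
    using that common outside glue.hyps unfolding U(1) hexagon_degree(1)[OF wnew]
    by (auto simp: graph_union_def)
  have "{v \<in> verts ?U. vertex_degree ?U v = 4} = insert w {v \<in> verts G. vertex_degree G v = 4}"
    using glue.hyps(2) deg by (auto simp: graph_union_def split: if_splits)
  then have "card {v \<in> verts ?U. vertex_degree ?U v = 4} = Suc (n - 1)"
    using G(1,5) glue.hyps(3) by (simp add: simple_graph_def)
  then show ?case using U G deg by auto
qed

section \<open>Support of the random chain\<close>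

lemma set_arrangement_pmf:
  assumes "0 < p1" "0 < p2" "0 < p3" "p1 + p2 + p3 = 1"
  shows "set_pmf (arrangement_pmf p1 p2 p3) \<subseteq> {1, 2, 3}"
proof -
  have "pmf_of_list_wf [(1::nat, p1), (2, p2), (3, p3)]"
    using assms by (intro pmf_of_list_wfI) auto
  from set_pmf_of_list[OF this] show ?thesis by (simp add: arrangement_pmf_def)
qed

lemma attachment_vertex_fresh:
  assumes "w \<notin> {(k,1),(k,2),(k,3),(k,4),(k,5)}" "i \<in> {1,2,3}"
  shows "attachment_vertex (hexagon k w) w i \<in> {(k,1),(k,2),(k,3),(k,4),(k,5)}"
proof -
  let ?x = "attachment_vertex (hexagon k w) w i"
  have x: "?x \<in> verts (hexagon k w)" "graph_dist (hexagon k w) w ?x = i"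
    using attachment_vertex_correct[OF assms] by auto
  have "graph_dist (hexagon k w) w w = 0"
    unfolding graph_dist_def by (rule Least_eq_0) simp
  with x(2) assms(2) have "?x \<noteq> w" by auto
  with x(1) show ?thesis by (simp add: hexagon_explicit)
qed

text \<open>The last hexagon is tracked together with the degrees of its unshared vertices: the next
  attachment vertex is one of them, at positive distance from the shared vertex \<open>v\<close>, so the step
  is an instance of the rule \<open>glue\<close>. The bound on \<open>fst v\<close> ensures that \<open>v\<close> differs from the fresh
  vertices of \<open>H\<close>.\<close>

lemma spiro_state_support:
  assumes "0 < p1" "0 < p2" "0 < p3" "p1 + p2 + p3 = 1"
    and "(G, H, v) \<in> set_pmf (spiro_state p1 p2 p3 (Suc (Suc m)))"
  shows "spiro_graph (Suc (Suc m)) G \<and> H = hexagon (Suc (Suc m)) v \<and> fst v < Suc (Suc m)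
    \<and> verts H \<subseteq> verts G \<and> (\<forall>x\<in>verts H. x \<noteq> v \<longrightarrow> vertex_degree G x = 2)"
  using assms(5)
proof (induction m arbitrary: G H v)
  case 0
  have first: "(1, 0) \<notin> {(1,1),(1,2),(1,3),(1,4),(1::nat,5::nat)}" by simp
  have second: "(1, 0) \<notin> {(2,1),(2,2),(2,3),(2,4),(2::nat,5::nat)}" by simp
  have w: "(1, 0) \<in> verts (hexagon 1 (1, 0))" by (simp add: hexagon_explicit)
  have "spiro_graph (Suc 1) (graph_union (hexagon 1 (1, 0)) (hexagon (Suc 1) (1, 0)))"
    using w hexagon_degree(1)[OF first] by (intro spiro_graph.intros) auto
  moreover have "vertex_degree (graph_union (hexagon 1 (1, 0)) (hexagon (Suc 1) (1, 0))) x = 2"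
    if "x \<in> verts (hexagon 2 (1, 0))" "x \<noteq> (1, 0)" for x
    unfolding glue_degree(1)[OF spiro_graph.single hexagon_simple_graph[OF first] w]
    using that hexagon_degree(1)[OF first] hexagon_degree(1)[OF second]
    by (auto simp: hexagon_explicit numeral_2_eq_2)
  ultimately show ?case
    using 0 by (auto simp: graph_union_def numeral_2_eq_2)
next
  case (Suc m)
  let ?n = "Suc (Suc m)"
  from Suc.prems obtain G0 H0 v0 i where
    st: "(G0, H0, v0) \<in> set_pmf (spiro_state p1 p2 p3 ?n)"
    and i: "i \<in> set_pmf (arrangement_pmf p1 p2 p3)"
    and v: "v = attachment_vertex H0 v0 i" and H: "H = hexagon (Suc ?n) v"
    and G: "G = graph_union G0 H"
    by (auto simp: Let_def)
  from Suc.IH[OF st] have IH: "spiro_graph ?n G0" "H0 = hexagon ?n v0" "fst v0 < ?n"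
    "verts H0 \<subseteq> verts G0" "\<forall>x\<in>verts H0. x \<noteq> v0 \<longrightarrow> vertex_degree G0 x = 2" by auto
  have i3: "i \<in> {1, 2, 3}" using i set_arrangement_pmf[OF assms(1-4)] by auto
  have "v0 \<notin> {(?n,1),(?n,2),(?n,3),(?n,4),(?n,5)}" using IH(3) by auto
  from attachment_vertex_fresh[OF this i3]
  have vin: "v \<in> {(?n,1),(?n,2),(?n,3),(?n,4),(?n,5)}" unfolding v IH(2) .
  then have vH0: "v \<in> verts H0" "v \<noteq> v0" using IH(2,3) by (auto simp: hexagon_explicit)
  then have vG0: "v \<in> verts G0" "vertex_degree G0 v = 2" using IH(4,5) by auto
  have chain: "spiro_graph (Suc ?n) G" unfolding G H by (intro spiro_graph.glue IH vG0)
  have G0: "simple_graph G0" using spiro_graph_structure[OF IH(1)] by blast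
  have vnew: "v \<notin> {(Suc ?n,1),(Suc ?n,2),(Suc ?n,3),(Suc ?n,4),(Suc ?n,5)}" using vin by auto
  have "vertex_degree G x = 2" if "x \<in> verts H" "x \<noteq> v" for x
  proof -
    have "fst x = Suc ?n" using that by (auto simp: H hexagon_explicit)
    then have "x \<notin> verts G0" using spiro_graph_verts[OF IH(1)] by (cases x) fastforce
    then have "vertex_degree G0 x = 0" by (rule vertex_degree_outside[OF G0])
    then show ?thesis
      using that unfolding G H glue_degree(1)[OF IH(1) G0 vG0(1)] hexagon_degree(1)[OF vnew] by simp
  qed
  then show ?case using chain H vin by (auto simp: G graph_union_def)
qed

lemma finite_spiro_state:
  assumes "0 < p1" "0 < p2" "0 < p3" "p1 + p2 + p3 = 1"
  shows "finite (set_pmf (spiro_state p1 p2 p3 (Suc (Suc m))))"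
proof (induction m)
  case (Suc m)
  have "finite (set_pmf (arrangement_pmf p1 p2 p3))"
    using set_arrangement_pmf[OF assms] finite_subset by blast
  with Suc show ?case by (auto simp: Let_def)
qed simp

section \<open>Variances\<close>

definition inner_edges :: "'v graph \<Rightarrow> real" where
  "inner_edges G = (\<Sum>e\<in>edges G. of_bool (\<forall>v\<in>e. vertex_degree G v = 4))"

text \<open>On an edge with \<open>k \<in> {0, 1, 2}\<close> ends of degree 4, the summand is the Newton interpolation
  polynomial \<open>f 2 2 + k (f 2 4 - f 2 2) + (k choose 2) c\<close>. The sum of \<open>k\<close> over all edges is the sum of
  the degrees of the \<open>n - 1\<close> cut vertices, and the sum of \<open>k choose 2\<close> is \<open>inner_edges\<close>.\<close>

lemma spiro_edge_sum:
  fixes f :: "real \<Rightarrow> real \<Rightarrow> real"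
  assumes "spiro_graph n G"
    and \<phi>: "\<And>u v. u \<noteq> v \<Longrightarrow> \<phi> {u, v} = f (vertex_degree G u) (vertex_degree G v)"
    and sym: "f 4 2 = f 2 4"
  shows "sum \<phi> (edges G) = 6 * real n * f 2 2 + 4 * (real n - 1) * (f 2 4 - f 2 2)
    + (f 2 2 - 2 * f 2 4 + f 4 4) * inner_edges G"
proof -
  let ?d = "vertex_degree G"
  let ?k = "\<lambda>e. (\<Sum>v\<in>e. of_bool (?d v = 4)) :: real"
  let ?in = "\<lambda>e. of_bool (\<forall>v\<in>e. ?d v = 4) :: real"
  let ?c = "f 2 2 - 2 * f 2 4 + f 4 4"
  from spiro_graph_structure[OF assms(1)] have G: "simple_graph G" "card (edges G) = 6 * n" "n \<ge> 1"
    "\<And>v. v \<in> verts G \<Longrightarrow> ?d v = 2 \<or> ?d v = 4"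
    "card {v \<in> verts G. ?d v = 4} = n - 1" by auto
  have edge: "\<phi> e = f 2 2 + (f 2 4 - f 2 2) * ?k e + ?c * ?in e" if "e \<in> edges G" for e
  proof -
    from G(1) that obtain u v where e: "e = {u, v}" "u \<noteq> v" "u \<in> verts G" "v \<in> verts G"
      by (rule simple_graph_edgeE)
    show ?thesis
      using G(4)[OF e(3)] G(4)[OF e(4)] e(2) sym by (auto simp: e(1) \<phi>)
  qed
  have "sum ?k (edges G) = (\<Sum>v\<in>verts G. real (?d v) * of_bool (?d v = 4))"
    by (rule weighted_handshake[OF G(1), symmetric])
  also have "\<dots> = (\<Sum>v\<in>{v \<in> verts G. ?d v = 4}. 4)"
    using G(1) by (intro sum.mono_neutral_cong_right) (auto simp: simple_graph_def)
  also have "\<dots> = 4 * (real n - 1)" using G(3,5) by (simp add: of_nat_diff)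
  finally have k: "sum ?k (edges G) = 4 * (real n - 1)" .
  have "sum \<phi> (edges G) = (\<Sum>e\<in>edges G. f 2 2 + (f 2 4 - f 2 2) * ?k e + ?c * ?in e)"
    using edge by (intro sum.cong) auto
  also have "\<dots> = real (card (edges G)) * f 2 2 + (f 2 4 - f 2 2) * sum ?k (edges G)
      + ?c * sum ?in (edges G)"
    by (simp add: sum.distrib sum_distrib_left)
  finally show ?thesis by (simp add: k G(2) inner_edges_def)
qed

lemma variance_pmf_affine:
  fixes X Y :: "'a \<Rightarrow> real"
  assumes "finite (set_pmf p)" "\<And>x. x \<in> set_pmf p \<Longrightarrow> Y x = a + c * X x"
  shows "measure_pmf.variance p Y = c\<^sup>2 * measure_pmf.variance p X"
proof -
  let ?E = "measure_pmf.expectation p"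
  have "?E Y = ?E (\<lambda>x. a + c * X x)"
    using assms(2) by (intro integral_cong_AE) (auto simp: AE_measure_pmf_iff)
  also have "\<dots> = a + c * ?E X"
    by (simp add: integrable_measure_pmf_finite[OF assms(1)])
  finally have EY: "?E Y = a + c * ?E X" .
  have "?E (\<lambda>x. (Y x - ?E Y)\<^sup>2) = ?E (\<lambda>x. c\<^sup>2 * (X x - ?E X)\<^sup>2)"
    unfolding EY using assms(2)
    by (intro integral_cong_AE) (auto simp: AE_measure_pmf_iff power2_eq_square algebra_simps)
  then show ?thesis by simp
qed

lemma spiro_index_variance:
  fixes f :: "real \<Rightarrow> real \<Rightarrow> real"
  assumes "finite (set_pmf p)" "\<And>G. G \<in> set_pmf p \<Longrightarrow> spiro_graph n G"
    and "\<And>G u v. u \<noteq> v \<Longrightarrow> \<phi> G {u, v} = f (vertex_degree G u) (vertex_degree G v)"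
    and "f 4 2 = f 2 4"
  shows "measure_pmf.variance p (\<lambda>G. sum (\<phi> G) (edges G))
    = (f 2 2 - 2 * f 2 4 + f 4 4)\<^sup>2 * measure_pmf.variance p inner_edges"
  using assms(1) spiro_edge_sum[OF assms(2) assms(3) assms(4)]
  by (rule variance_pmf_affine)

text \<open>The second differences of the Nirmala and Sombor summands are negative, hence the comparison of
  squares. The first inequality has the least slack, about 0.028; it dictates the precision of the
  bounds on \<open>sqrt 2\<close> and \<open>sqrt 6\<close>.\<close>

lemma second_difference_bounds:
  defines "c \<equiv> \<lambda>f :: real \<Rightarrow> real \<Rightarrow> real. f 2 2 - 2 * f 2 4 + f 4 4"
  shows "(c (\<lambda>a b. (a * b) powr (- 1 / 2)))\<^sup>2 \<le> (c (\<lambda>a b. sqrt (a + b)))\<^sup>2"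
    and "(c (\<lambda>a b. sqrt (a + b)))\<^sup>2 \<le> (c (\<lambda>a b. sqrt (a\<^sup>2 + b\<^sup>2)))\<^sup>2"
    and "(c (\<lambda>a b. sqrt (a\<^sup>2 + b\<^sup>2)))\<^sup>2 \<le> (c (\<lambda>a b. a * b))\<^sup>2"
proof -
  have s2: "1414 / 1000 \<le> sqrt 2" "sqrt 2 \<le> 14143 / 10000"
    by (rule real_le_rsqrt real_le_lsqrt; simp add: power2_eq_square)+
  have s5: "2236 / 1000 \<le> sqrt 5" "sqrt 5 \<le> 22361 / 10000"
    by (rule real_le_rsqrt real_le_lsqrt; simp add: power2_eq_square)+
  have s6: "2449 / 1000 \<le> sqrt 6" "sqrt 6 \<le> 245 / 100"
    by (rule real_le_rsqrt real_le_lsqrt; simp add: power2_eq_square)+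
  have roots: "sqrt 4 = 2" "sqrt 8 = 2 * sqrt 2" "sqrt 16 = 4" "sqrt 20 = 2 * sqrt 5"
    "sqrt 32 = 4 * sqrt 2"
    using real_sqrt_mult[of 4 2] real_sqrt_mult[of 4 5] real_sqrt_mult[of 16 2]
      real_sqrt_abs[of 2] real_sqrt_abs[of 4] by simp_all
  have inv: "x powr - (1 / 2) = 1 / sqrt x" if "x > 0" for x :: real
    using that by (simp add: powr_minus_divide powr_half_sqrt)
  have R: "c (\<lambda>a b. (a * b) powr (- 1 / 2)) = 3 / 4 - sqrt 2 / 2"
    by (simp add: c_def inv roots field_simps)
  have N: "c (\<lambda>a b. sqrt (a + b)) = 2 - 2 * sqrt 6 + 2 * sqrt 2"
    by (simp add: c_def roots)
  have S: "c (\<lambda>a b. sqrt (a\<^sup>2 + b\<^sup>2)) = 6 * sqrt 2 - 4 * sqrt 5"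
    by (simp add: c_def roots)
  have M: "c (\<lambda>a b. a * b) = 4" by (simp add: c_def)
  show "(c (\<lambda>a b. (a * b) powr (- 1 / 2)))\<^sup>2 \<le> (c (\<lambda>a b. sqrt (a + b)))\<^sup>2"
    unfolding R N abs_le_square_iff[symmetric] using s2 s6 by linarith
  show "(c (\<lambda>a b. sqrt (a + b)))\<^sup>2 \<le> (c (\<lambda>a b. sqrt (a\<^sup>2 + b\<^sup>2)))\<^sup>2"
    unfolding N S abs_le_square_iff[symmetric] using s2 s5 s6 by linarith
  show "(c (\<lambda>a b. sqrt (a\<^sup>2 + b\<^sup>2)))\<^sup>2 \<le> (c (\<lambda>a b. a * b))\<^sup>2"
    unfolding S M abs_le_square_iff[symmetric] using s2 s5 by linarith
qed

section \<open>Comparison of the indices\<close>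

theorem mainTheorem8:
  fixes n :: nat and p1 p2 p3 :: real
  assumes "n \<ge> 2"
    and "0 < p1" "p1 < 1" and "0 < p2" "p2 < 1" and "0 < p3" "p3 < 1"
    and "p1 + p2 + p3 = 1"
  defines "RSC \<equiv> random_spiro_chain p1 p2 p3 n"
  shows "measure_pmf.expectation RSC randic_index \<le> measure_pmf.expectation RSC nirmala_index
      \<and> measure_pmf.expectation RSC nirmala_index \<le> measure_pmf.expectation RSC sombor_index
      \<and> measure_pmf.expectation RSC sombor_index \<le> measure_pmf.expectation RSC first_zagreb_index
      \<and> measure_pmf.expectation RSC first_zagreb_index \<le> measure_pmf.expectation RSC second_zagreb_index
      \<and> measure_pmf.variance RSC randic_index \<le> measure_pmf.variance RSC nirmala_index
      \<and> measure_pmf.variance RSC nirmala_index \<le> measure_pmf.variance RSC sombor_index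
      \<and> measure_pmf.variance RSC sombor_index \<le> measure_pmf.variance RSC second_zagreb_index"
proof -
  obtain m where n: "n = Suc (Suc m)"
    using \<open>n \<ge> 2\<close> by (metis Suc_le_D numeral_2_eq_2 Suc_le_mono)
  have supp: "spiro_graph n G" if "G \<in> set_pmf RSC" for G
    using that spiro_state_support[OF \<open>0 < p1\<close> \<open>0 < p2\<close> \<open>0 < p3\<close> \<open>p1 + p2 + p3 = 1\<close>]
    unfolding RSC_def random_spiro_chain_def n by fastforce
  have fin: "finite (set_pmf RSC)"
    using finite_spiro_state[OF \<open>0 < p1\<close> \<open>0 < p2\<close> \<open>0 < p3\<close> \<open>p1 + p2 + p3 = 1\<close>, of m]
    by (simp add: RSC_def random_spiro_chain_def n)
  have mono: "measure_pmf.expectation RSC X \<le> measure_pmf.expectation RSC Y"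
    if le: "\<And>G. simple_graph G \<Longrightarrow> (\<And>v. v \<in> verts G \<Longrightarrow> vertex_degree G v \<ge> 2) \<Longrightarrow> X G \<le> Y G"
    for X Y :: "vertex graph \<Rightarrow> real"
  proof (rule integral_mono_AE)
    have "X G \<le> Y G" if "G \<in> set_pmf RSC" for G
      using spiro_graph_structure[OF supp[OF that]]
      by (intro le) force+
    then show "AE G in measure_pmf RSC. X G \<le> Y G" by (simp add: AE_measure_pmf_iff)
  qed (auto intro: integrable_measure_pmf_finite fin)
  note var = spiro_index_variance[of RSC n, OF fin supp]
  let ?V = "measure_pmf.variance RSC inner_edges"
  let ?c = "\<lambda>f :: real \<Rightarrow> real \<Rightarrow> real. f 2 2 - 2 * f 2 4 + f 4 4"
  have R: "measure_pmf.variance RSC randic_index = (?c (\<lambda>a b. (a * b) powr (- 1 / 2)))\<^sup>2 * ?V"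
    unfolding randic_index_def by (rule var) (simp_all add: mult.commute)
  have N: "measure_pmf.variance RSC nirmala_index = (?c (\<lambda>a b. sqrt (a + b)))\<^sup>2 * ?V"
    unfolding nirmala_index_def by (rule var) simp_all
  have S: "measure_pmf.variance RSC sombor_index = (?c (\<lambda>a b. sqrt (a\<^sup>2 + b\<^sup>2)))\<^sup>2 * ?V"
    unfolding sombor_index_def by (rule var) simp_all
  have M: "measure_pmf.variance RSC second_zagreb_index = (?c (\<lambda>a b. a * b))\<^sup>2 * ?V"
    unfolding second_zagreb_index_def by (rule var) simp_all
  have V: "0 \<le> ?V" by (rule measure_pmf.variance_positive)
  show ?thesis
    unfolding R N S M
    by (intro conjI mono mult_right_mono[OF _ V] second_difference_bounds
        randic_index_le_nirmala_index nirmala_index_le_sombor_index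
        sombor_index_le_first_zagreb_index first_zagreb_index_le_second_zagreb_index)
qed

end
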